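(* There exists a constant $\epsilon_0>0$ such that the following holds. If $n\ge1$, $0\le\epsilon\le\epsilon_0$, and $f\colon S_n\to\mathbb{R}$ is linear with $\operatorname{dist}(f(\pi),\{0,1\})\le\epsilon$ for all $\pi\in S_n$, then the function $g(\pi)=\operatorname{round}(f(\pi),\{0,1\})$ is a dictator.
   Context: $S_n$ is the symmetric group on $[n]$. $x_{i,j}(\pi)=1$ if $\pi(i)=j$ and $0$ otherwise; $f$ is linear if $f=\sum_{i,j}c_{i,j}x_{i,j}$ for reals $c_{i,j}$. $\operatorname{dist}(y,\{0,1\})=\min(|y|,|y-1|)$ and $\operatorname{round}(y,\{0,1\})$ is the element of $\{0,1\}$ nearest to $y$. A dictator is a function of the form $\sum_{(i,j)\in\mathcal{C}}x_{i,j}$ where either all elements of $\mathcal{C}\subseteq[n]^2$ have the same first coordinate or all have the same second coordinate; equivalently, a $\{0,1\}$-valued function such that either $f(\pi)$ depends only on $\pi(i)$ for some $i$, or only on $\pi^{-1}(j)$ for some $j$. *)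

theory Defs
  imports Complex_Main "HOL-Combinatorics.Permutations"
begin

text \<open>The symmetric group on \<open>[n] = {1..n}\<close>. A function \<open>S\<^sub>n \<rightarrow> \<real>\<close> is represented by a
  function on \<open>nat \<Rightarrow> nat\<close> of which only the values on \<open>Sym n\<close> matter.\<close>

definition Sym :: "nat \<Rightarrow> (nat \<Rightarrow> nat) set" where
  "Sym n = {\<pi>. \<pi> permutes {1..n}}"

definition xvar :: "nat \<Rightarrow> nat \<Rightarrow> (nat \<Rightarrow> nat) \<Rightarrow> real" where
  "xvar i j \<pi> = (if \<pi> i = j then 1 else 0)"

definition linear_on_Sym :: "nat \<Rightarrow> ((nat \<Rightarrow> nat) \<Rightarrow> real) \<Rightarrow> bool" where
  "linear_on_Sym n f \<longleftrightarrow>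
     (\<exists>c :: nat \<Rightarrow> nat \<Rightarrow> real. \<forall>\<pi>\<in>Sym n. f \<pi> = (\<Sum>i\<in>{1..n}. \<Sum>j\<in>{1..n}. c i j * xvar i j \<pi>))"

definition dist01 :: "real \<Rightarrow> real" where
  "dist01 y = min \<bar>y\<bar> \<bar>y - 1\<bar>"

text \<open>At the tie \<open>y = 1/2\<close> the value is an unspecified one of 0 and 1.\<close>

definition round01 :: "real \<Rightarrow> real" where
  "round01 y = arg_min_on (\<lambda>b. \<bar>y - b\<bar>) {0, 1}"

definition dictator :: "nat \<Rightarrow> ((nat \<Rightarrow> nat) \<Rightarrow> real) \<Rightarrow> bool" where
  "dictator n g \<longleftrightarrow>
     (\<exists>C \<subseteq> {1..n} \<times> {1..n}.
        ((\<exists>i. \<forall>p\<in>C. fst p = i) \<or> (\<exists>j. \<forall>p\<in>C. snd p = j)) \<and>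
        (\<forall>\<pi>\<in>Sym n. g \<pi> = (\<Sum>(i, j)\<in>C. xvar i j \<pi>)))"

end

theory Submission
  imports Defs
begin

text \<open>
  Composing \<open>\<pi>\<close> with the transposition of \<open>a\<close> and \<open>b\<close> changes \<open>f\<close> by the signed \<open>2 \<times> 2\<close> minor
  \<open>c a j + c b k - c a k - c b j\<close>, where \<open>j = \<pi> a\<close> and \<open>k = \<pi> b\<close>. The corresponding change of the
  rounded function \<open>g\<close> is an integer within \<open>2\<epsilon>\<close> of it, and minors add up, so for small \<open>\<epsilon>\<close> the
  rounded minors are the minors of an integer matrix. As transpositions generate the symmetric group,
  \<open>g\<close> is exactly linear, with integer coefficients.

  For a Boolean linear function, two nonzero minors with disjoint rows and disjoint columns are
  impossible, since the two transpositions together could change the value by 2. For \<open>n \<ge> 4\<close> it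
  follows that all minors avoiding some row, or all minors avoiding some column, vanish, and then \<open>g\<close>
  depends only on one value of \<open>\<pi>\<close> or of its inverse.
\<close>

section \<open>Extending partial injections to permutations\<close>

text \<open>Induction on \<open>B\<close>: composing on the left with the transposition of
  \<open>\<pi> x\<close> and \<open>f x\<close> repairs the value at \<open>x\<close>. The values at
  earlier points differ from both and stay as they are.\<close>

lemma permutes_extend:
  assumes "finite B" "inj_on f B" "B \<subseteq> A" "f ` B \<subseteq> A"
  shows "\<exists>\<pi>. \<pi> permutes A \<and> (\<forall>x\<in>B. \<pi> x = f x)"
  using assms
proof (induction B)
  case empty
  show ?case by (auto intro: exI[of _ id] permutes_id)
next
  case (insert x B)
  then obtain \<pi> where \<pi>: "\<pi> permutes A" "\<forall>y\<in>B. \<pi> y = f y" by auto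
  have "transpose (\<pi> x) (f x) permutes A"
    using insert.prems \<pi>(1) by (intro permutes_swap_id) (auto simp: permutes_in_image)
  then have "transpose (\<pi> x) (f x) \<circ> \<pi> permutes A"
    using \<pi>(1) permutes_compose by blast
  moreover have "(transpose (\<pi> x) (f x) \<circ> \<pi>) y = f y" if "y \<in> insert x B" for y
  proof (cases "y = x")
    case False
    then have y: "y \<in> B" "\<pi> y = f y" "f y \<noteq> f x"
      using that \<pi>(2) insert.prems(1) insert.hyps(2) by (auto simp: inj_on_def)
    moreover have "\<pi> y \<noteq> \<pi> x" using \<pi>(1) False by (metis permutes_inj injD)
    ultimately show ?thesis by (auto simp: transpose_def)
  qed (simp add: transpose_def)
  ultimately show ?case by blast
qed

lemma permutes_extend_list:
  assumes "distinct xs" "distinct ys" "length xs = length ys" "set xs \<subseteq> A" "set ys \<subseteq> A"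
  shows "\<exists>\<pi>. \<pi> permutes A \<and> map \<pi> xs = ys"
proof -
  define f where "f = the \<circ> map_of (zip xs ys)"
  have f: "map f xs = ys"
    using assms by (auto simp: f_def map_of_zip_nth intro!: nth_equalityI)
  have "inj_on f (set xs)" using assms f by (metis distinct_map)
  moreover have "f ` set xs \<subseteq> A" using f assms by (metis set_map)
  ultimately obtain \<pi> where "\<pi> permutes A" "\<forall>x\<in>set xs. \<pi> x = f x"
    using permutes_extend[of "set xs" f A] assms by auto
  then show ?thesis using f by (metis map_cong)
qed

section \<open>Additive minors and transpositions\<close>

text \<open>Additive analogue of a 2 x 2 determinant: all minors vanish iff \<open>C\<close> is a
  function of the row plus a function of the column.\<close>

definition minor :: "('a \<Rightarrow> 'b \<Rightarrow> 'c::ab_group_add) \<Rightarrow> 'a \<Rightarrow> 'a \<Rightarrow> 'b \<Rightarrow> 'b \<Rightarrow> 'c" where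
  "minor C a b j k = C a j + C b k - C a k - C b j"

lemma sum_diff_transpose:
  fixes C :: "'a \<Rightarrow> 'b \<Rightarrow> 'c::ab_group_add"
  assumes "finite A" "a \<in> A" "b \<in> A"
  shows "(\<Sum>i\<in>A. C i (\<pi> i)) - (\<Sum>i\<in>A. C i ((\<pi> \<circ> transpose a b) i)) = minor C a b (\<pi> a) (\<pi> b)"
proof (cases "a = b")
  case False
  have "(\<Sum>i\<in>A. C i (\<pi> i)) - (\<Sum>i\<in>A. C i ((\<pi> \<circ> transpose a b) i)) =
      (\<Sum>i\<in>A. C i (\<pi> i) - C i ((\<pi> \<circ> transpose a b) i))"
    by (simp add: sum_subtractf)
  also have "\<dots> = (\<Sum>i\<in>{a, b}. C i (\<pi> i) - C i ((\<pi> \<circ> transpose a b) i))"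
    using assms by (intro sum.mono_neutral_right) (auto simp: transpose_def)
  also have "\<dots> = minor C a b (\<pi> a) (\<pi> b)"
    using False by (simp add: minor_def)
  finally show ?thesis .
qed (simp add: minor_def)

section \<open>Pairs of functions that never vary on disjoint pairs of points\<close>

lemma ex_other:
  assumes "card A \<ge> 4"
  obtains z where "z \<in> A" "z \<noteq> a" "z \<noteq> b" "z \<noteq> c"
proof -
  have "\<not> A \<subseteq> {a, b, c}"
  proof
    assume "A \<subseteq> {a, b, c}"
    then have "card A \<le> card {a, b, c}" by (intro card_mono) auto
    also have "\<dots> \<le> 3" by (simp add: card_insert_if)
    finally show False using assms by simp
  qed
  then show ?thesis using that by auto
qed

text \<open>The pairs on which \<open>u\<close> and \<open>v\<close> vary share the point
  \<open>x\<close>. By \<open>cross\<close>, \<open>v x\<close> differs from \<open>v\<close> at all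
  points other than \<open>x\<close> and \<open>y\<close>, which forces \<open>u\<close> to be
  constant off \<open>x\<close>. Then \<open>u x\<close> differs from all other values of
  \<open>u\<close>, which forces \<open>v\<close> to be constant off \<open>x\<close> as
  well.\<close>

lemma cross_constant_aux:
  assumes card: "card A \<ge> 4"
    and cross: "\<And>j k l m. \<lbrakk>distinct [j, k, l, m]; {j, k, l, m} \<subseteq> A\<rbrakk> \<Longrightarrow> u j = u k \<or> v l = v m"
    and A: "x \<in> A" "y \<in> A" "w \<in> A" and neq: "u x \<noteq> u y" "w \<noteq> y" "v x \<noteq> v w"
  shows "\<forall>j\<in>A - {x}. \<forall>k\<in>A - {x}. u j = u k \<and> v j = v k"
proof -
  have "x \<noteq> y" "x \<noteq> w" using neq by auto
  then have v: "v x \<noteq> v k" if "k \<in> A" "k \<noteq> x" "k \<noteq> y" for k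
    using cross[of x y k w] A neq that by (cases "k = w") auto
  have u: "u j = u y" if "j \<in> A" "j \<noteq> x" for j
  proof (cases "j = y")
    case False
    obtain k where "k \<in> A" "k \<noteq> x" "k \<noteq> y" "k \<noteq> j" using ex_other[OF card] by metis
    then show ?thesis using cross[of j y x k] v[of k] A neq that False by auto
  qed simp
  have "v j = v k" if jk: "j \<in> A" "j \<noteq> x" "k \<in> A" "k \<noteq> x" for j k
  proof -
    obtain m where "m \<in> A" "m \<noteq> x" "m \<noteq> j" "m \<noteq> k" using ex_other[OF card] by metis
    then show ?thesis using cross[of x m j k] u[of m] A neq jk by auto
  qed
  then show ?thesis using u by auto
qed

text \<open>To be applied with \<open>u\<close> and \<open>v\<close> the differences of two disjoint
  pairs of rows; \<open>p\<close> is then a column off which both differences are constant.\<close>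

lemma cross_constant:
  assumes card: "card A \<ge> 4"
    and cross: "\<And>j k l m. \<lbrakk>distinct [j, k, l, m]; {j, k, l, m} \<subseteq> A\<rbrakk> \<Longrightarrow> u j = u k \<or> v l = v m"
    and u: "x \<in> A" "y \<in> A" "u x \<noteq> u y"
    and v: "z \<in> A" "w \<in> A" "v z \<noteq> v w"
  shows "\<exists>p\<in>A. \<forall>j\<in>A - {p}. \<forall>k\<in>A - {p}. u j = u k \<and> v j = v k"
\<comment> \<open>Since \<open>v\<close> is not constant, such a third point \<open>t\<close>
  exists. It gives a pair on which \<open>v\<close> varies and which meets \<open>x\<close>,
  \<open>y\<close> in exactly one point, the situation of \<open>cross_constant_aux\<close>.\<close>
proof (cases "\<exists>t\<in>A. t \<noteq> x \<and> t \<noteq> y \<and> (v x \<noteq> v t \<or> v y \<noteq> v t)")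
  case True
  then obtain t where t: "t \<in> A" "t \<noteq> x" "t \<noteq> y" "v x \<noteq> v t \<or> v y \<noteq> v t" by blast
  from t(4) show ?thesis
  proof
    assume "v x \<noteq> v t"
    then show ?thesis
      by (intro bexI[OF _ u(1)] cross_constant_aux[of A u v x y t, OF card cross u(1,2) t(1) u(3) t(3)])
  next
    assume "v y \<noteq> v t"
    then show ?thesis
      by (intro bexI[OF _ u(2)]
          cross_constant_aux[of A u v y x t, OF card cross u(2,1) t(1) u(3)[symmetric] t(2)])
  qed
next
  case False
  then have "v t = v x" if "t \<in> A" "t \<noteq> y" for t using that by metis
  moreover obtain t where "t \<in> A" "t \<noteq> x" "t \<noteq> y" using ex_other[OF card] by metis
  then have "v y = v x" using False by metis
  ultimately have False using v by metis
  then show ?thesis ..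
qed

section \<open>Minors concentrated on one row or one column\<close>

lemma minor_rows: "minor C a c j k = minor C a b j k + minor C b c j k"
  by (simp add: minor_def algebra_simps)

lemma minor_cols: "minor C a b j l = minor C a b j k + minor C a b k l"
  by (simp add: minor_def algebra_simps)

lemma minor_swap_rows: "minor C b a j k = - minor C a b j k"
  by (simp add: minor_def algebra_simps)

lemma minor_swap_cols: "minor C a b k j = - minor C a b j k"
  by (simp add: minor_def algebra_simps)

text \<open>As a graph on \<open>A\<close>, \<open>R\<close> has no vertex meeting all edges, so it
  contains two disjoint edges or a triangle. In a triangle, cotransitivity through a fourth point
  gives an edge at that point which is disjoint from one of the sides.\<close>

lemma disjoint_related_pairs:
  assumes card: "card A \<ge> 4"
    and sym: "\<And>a b. R a b \<Longrightarrow> R b a"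
    and cotrans: "\<And>a b c. R a c \<Longrightarrow> R a b \<or> R b c"
    and ex: "\<And>i. i \<in> A \<Longrightarrow> \<exists>a\<in>A - {i}. \<exists>b\<in>A - {i}. R a b"
    and irrefl: "\<And>a. \<not> R a a"
  obtains a b c d where "distinct [a, b, c, d]" "{a, b, c, d} \<subseteq> A" "R a b" "R c d"
proof -
  obtain i where "i \<in> A" using ex_other[OF card] by metis
  then obtain a b where ab: "a \<in> A" "b \<in> A" "R a b" using ex by blast
  have "a \<noteq> b" using ab irrefl by auto
  obtain c d where cd: "c \<in> A" "d \<in> A" "c \<noteq> a" "d \<noteq> a" "R c d" using ex[OF ab(1)] by auto
  have "c \<noteq> d" using cd irrefl by auto
  show ?thesis
  proof (cases "b = c \<or> b = d")
    case False
    then show ?thesis using that[of a b c d] ab cd \<open>a \<noteq> b\<close> \<open>c \<noteq> d\<close> by auto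
  next
    case True
    then obtain d' where d': "d' \<in> A" "d' \<noteq> a" "d' \<noteq> b" "R b d'"
      using cd sym \<open>c \<noteq> d\<close> by metis
    obtain e f where ef: "e \<in> A" "f \<in> A" "e \<noteq> b" "f \<noteq> b" "R e f" using ex[OF ab(2)] by auto
    have "e \<noteq> f" using ef irrefl by auto
    \<comment> \<open>If neither of the first two cases holds, \<open>e\<close> and \<open>f\<close>
      are \<open>a\<close> and \<open>d'\<close> in some order, which closes a triangle.\<close>
    consider "e \<noteq> a" "f \<noteq> a" | "e \<noteq> d'" "f \<noteq> d'" | "R a d'"
      using ef sym \<open>e \<noteq> f\<close> d'(2) by metis
    then show ?thesis
    proof cases
      case 1
      then show ?thesis using that[of a b e f] ab ef \<open>a \<noteq> b\<close> \<open>e \<noteq> f\<close> by auto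
    next
      case 2
      then show ?thesis using that[of b d' e f] ab d' ef \<open>e \<noteq> f\<close> by auto
    next
      case 3
      obtain x where x: "x \<in> A" "x \<noteq> a" "x \<noteq> b" "x \<noteq> d'" using ex_other[OF card] by metis
      from cotrans[OF ab(3), of x] show ?thesis
        using that[of a x b d'] that[of x b a d'] x ab d' 3 \<open>a \<noteq> b\<close> by auto
    qed
  qed
qed

text \<open>If no row meets all nonzero minors, some two disjoint pairs of rows both have nonzero
  minors. By \<open>cross_constant\<close> they share a centre column \<open>p\<close>, and
  \<open>p\<close> then turns out to be a centre for every pair of rows.\<close>

lemma row_or_column_star:
  fixes C :: "'a \<Rightarrow> 'a \<Rightarrow> 'c::ab_group_add"
  assumes card: "card A \<ge> 4"
    and cross: "\<And>a b c d j k l m. \<lbrakk>distinct [a, b, c, d]; {a, b, c, d} \<subseteq> A;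
        distinct [j, k, l, m]; {j, k, l, m} \<subseteq> A\<rbrakk> \<Longrightarrow> minor C a b j k = 0 \<or> minor C c d l m = 0"
  shows "(\<exists>i\<in>A. \<forall>a\<in>A - {i}. \<forall>b\<in>A - {i}. \<forall>j\<in>A. \<forall>k\<in>A. minor C a b j k = 0) \<or>
         (\<exists>p\<in>A. \<forall>a\<in>A. \<forall>b\<in>A. \<forall>j\<in>A - {p}. \<forall>k\<in>A - {p}. minor C a b j k = 0)"
proof (cases "\<exists>i\<in>A. \<forall>a\<in>A - {i}. \<forall>b\<in>A - {i}. \<forall>j\<in>A. \<forall>k\<in>A. minor C a b j k = 0")
  case False
  \<comment> \<open>\<open>R a b\<close> means that rows \<open>a\<close> and \<open>b\<close> do
    not differ by a constant; \<open>V a b p\<close> means that they do away from column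
    \<open>p\<close>, the centre.\<close>
  define R where "R a b \<longleftrightarrow> (\<exists>j\<in>A. \<exists>k\<in>A. minor C a b j k \<noteq> 0)" for a b
  define V where "V a b p \<longleftrightarrow> (\<forall>j\<in>A - {p}. \<forall>k\<in>A - {p}. minor C a b j k = 0)" for a b p
  have V_sym: "V b a p" if "V a b p" for a b p
    using that minor_swap_rows[of C] unfolding V_def by (metis neg_equal_0_iff_equal)
  have V_trans: "V a c p" if "V a b p" "V b c p" for a b c p
    using that minor_rows[of C a c _ _ b] unfolding V_def by simp
  have star: "\<exists>p\<in>A. V a b p \<and> V c d p"
    if "R a b" "R c d" "distinct [a, b, c, d]" "{a, b, c, d} \<subseteq> A" for a b c d
  proof -
    have diff: "minor C i i' j k = (C i j - C i' j) - (C i k - C i' k)" for i i' j k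
      by (simp add: minor_def algebra_simps)
    have *: "minor C i i' j k = 0 \<longleftrightarrow> C i j - C i' j = C i k - C i' k" for i i' j k
      unfolding diff by simp
    obtain x y z w where "x \<in> A" "y \<in> A" "minor C a b x y \<noteq> 0"
      "z \<in> A" "w \<in> A" "minor C c d z w \<noteq> 0"
      using \<open>R a b\<close> \<open>R c d\<close> unfolding R_def by blast
    then have "\<exists>p\<in>A. \<forall>j\<in>A - {p}. \<forall>k\<in>A - {p}.
        C a j - C b j = C a k - C b k \<and> C c j - C d j = C c k - C d k"
      using cross[OF that(3,4)] unfolding * by (intro cross_constant[OF card, of _ _ x y z w]) auto
    then show ?thesis unfolding V_def * by blast
  qed
  \<comment> \<open>With two centres, every column can be compared with a third column
    \<open>z\<close>, so all minors of the two rows vanish.\<close>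
  have centre_unique: "p = q" if "R a b" "V a b p" "V a b q" "p \<in> A" "q \<in> A" for a b p q
  proof (rule ccontr)
    assume "p \<noteq> q"
    obtain z where z: "z \<in> A" "z \<noteq> p" "z \<noteq> q" using ex_other[OF card] by metis
    have "minor C a b j z = 0" if "j \<in> A" for j
      using \<open>V a b p\<close> \<open>V a b q\<close> \<open>p \<noteq> q\<close> z that unfolding V_def by (cases "j = p") auto
    then have "minor C a b j k = 0" if "j \<in> A" "k \<in> A" for j k
      using that minor_cols[of C a b j k z] minor_swap_cols[of C a b z k] by simp
    then show False using \<open>R a b\<close> unfolding R_def by blast
  qed
  have R_sym: "R b a" if "R a b" for a b
    using that minor_swap_rows[of C] unfolding R_def by (metis neg_equal_0_iff_equal)
  have R_cotrans: "R a b \<or> R b c" if "R a c" for a b c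
    using that minor_rows[of C a c _ _ b] unfolding R_def by (metis add.right_neutral)
  have R_ex: "\<exists>a\<in>A - {i}. \<exists>b\<in>A - {i}. R a b" if "i \<in> A" for i
    using False that unfolding R_def by blast
  have R_irrefl: "\<not> R a a" for a unfolding R_def by (simp add: minor_def)
  obtain a b c d where abcd: "distinct [a, b, c, d]" "{a, b, c, d} \<subseteq> A" "R a b" "R c d"
    by (rule disjoint_related_pairs[of A R, OF card R_sym R_cotrans R_ex R_irrefl])
  then obtain p where p: "p \<in> A" "V a b p" "V c d p" using star by blast
  \<comment> \<open>The disjoint pairs share a centre, which must be \<open>p\<close> by uniqueness
    for \<open>a'\<close>, \<open>b'\<close>.\<close>
  have far: "V x y p" if xy: "R x y" "{x, y} \<subseteq> A" "x \<noteq> y" "R a' b'" "V a' b' p" "{a', b'} \<subseteq> A"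
      "a' \<noteq> b'" "{x, y} \<inter> {a', b'} = {}" for x y a' b'
  proof -
    obtain q where "q \<in> A" "V x y q" "V a' b' q" using star[of x y a' b'] xy by auto
    then show ?thesis using centre_unique[of a' b' p q] p xy by auto
  qed
  \<comment> \<open>Off \<open>p\<close>, the row pairs \<open>a c\<close>, \<open>a d\<close>,
    \<open>b c\<close>, \<open>b d\<close> have equal minors. If one is nonzero, \<open>a c\<close>
    and \<open>b d\<close> share a centre \<open>q\<close>, and \<open>a d\<close> and
    \<open>b c\<close> share a centre \<open>r\<close>, both in \<open>{j, k}\<close>. Equality of
    \<open>q\<close> and \<open>r\<close> would give \<open>a b\<close> a second centre; otherwise a
    column \<open>z\<close> connects \<open>q\<close> to \<open>r\<close> through zero
    minors.\<close>
  have near: "V a c p"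
    if ab: "R a b" "V a b p" and cd: "R c d" "V c d p"
      and dist: "distinct [a, b, c, d]" "{a, b, c, d} \<subseteq> A" for a b c d
  proof (rule ccontr)
    assume "\<not> V a c p"
    then obtain j k where jk: "j \<in> A - {p}" "k \<in> A - {p}" "minor C a c j k \<noteq> 0"
      unfolding V_def by blast
    have eq: "minor C b c l m = minor C a c l m" "minor C a d l m = minor C a c l m"
        "minor C b d l m = minor C a c l m"
      if "l \<in> A - {p}" "m \<in> A - {p}" for l m
    proof -
      have "minor C a b l m = 0" "minor C c d l m = 0"
        using ab cd that unfolding V_def by auto
      then show "minor C b c l m = minor C a c l m" "minor C a d l m = minor C a c l m"
        "minor C b d l m = minor C a c l m"
        using minor_rows[of C a c l m b] minor_rows[of C a d l m c] minor_rows[of C a d l m b]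
        by auto
    qed
    have "R s t" if "minor C s t j k \<noteq> 0" for s t using that jk unfolding R_def by blast
    then have "R a c" "R b d" "R a d" "R b c" using jk eq[of j k] by auto
    then obtain q r where q: "q \<in> A" "V a c q" "V b d q" and r: "r \<in> A" "V a d r" "V b c r"
      using star[of a c b d] star[of a d b c] dist by auto
    have qjk: "q = j \<or> q = k" using jk q unfolding V_def by blast
    have rjk: "r = j \<or> r = k" using jk r eq unfolding V_def by (metis Diff_iff singletonD)
    have "q \<noteq> r"
    proof
      assume "q = r"
      then have "V a b q" using q r V_sym V_trans by blast
      then show False using centre_unique[of a b p q] ab p q qjk jk by auto
    qed
    obtain z where z: "z \<in> A" "z \<noteq> p" "z \<noteq> q" "z \<noteq> r" using ex_other[OF card] by metis
    have "minor C a c r z = 0" using q r z \<open>q \<noteq> r\<close> unfolding V_def by auto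
    moreover have "minor C b c q z = 0" using q r z \<open>q \<noteq> r\<close> unfolding V_def by auto
    then have "minor C a c q z = 0" using eq[of q z] qjk jk q z by auto
    ultimately have "minor C a c q r = 0"
      using minor_cols[of C a c q r z] minor_swap_cols[of C a c r z] by simp
    then have "minor C a c j k = 0"
      using qjk rjk \<open>q \<noteq> r\<close> minor_swap_cols[of C a c q r] by auto
    then show False using jk by simp
  qed
  have "V x y p" if xy: "x \<in> A" "y \<in> A" for x y
  proof (cases "R x y")
    case False
    then show ?thesis unfolding R_def V_def by blast
  next
    case True
    have "x \<noteq> y" using True R_irrefl by auto
    have sym: "R b a" "V b a p" "R d c" "V d c p" using R_sym V_sym abcd p by auto
    \<comment> \<open>A pair of rows misses \<open>{a, b}\<close>, misses \<open>{c, d}\<close>, or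
      has one row in each: \<open>far\<close> treats the first two cases and \<open>near\<close> the
      others.\<close>
    consider "{x, y} \<inter> {a, b} = {}" | "{x, y} \<inter> {c, d} = {}"
      | "x \<in> {a, b}" "y \<in> {c, d}" | "y \<in> {a, b}" "x \<in> {c, d}"
      using abcd(1) by auto
    then show ?thesis
    proof cases
      case 1
      show ?thesis using far[OF True _ _ abcd(3) p(2)] 1 xy \<open>x \<noteq> y\<close> abcd by auto
    next
      case 2
      show ?thesis using far[OF True _ _ abcd(4) p(3)] 2 xy \<open>x \<noteq> y\<close> abcd by auto
    next
      case 3
      then show ?thesis
        using near[of a b c d] near[of b a c d] near[of a b d c] near[of b a d c] abcd p sym by auto
    next
      case 4
      then have "V y x p"
        using near[of a b c d] near[of b a c d] near[of a b d c] near[of b a d c] abcd p sym by auto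
      then show ?thesis by (rule V_sym)
    qed
  qed
  then show ?thesis using p(1) unfolding V_def by blast
qed blast

section \<open>Boolean linear functions with integer coefficients\<close>

text \<open>The two transpositions act independently. Nonzero minors of equal sign make
  \<open>F\<close> change by 2 under both together; with opposite signs, the values after each
  single transposition differ by 2.\<close>

lemma disjoint_minors_vanish:
  fixes C :: "'a \<Rightarrow> 'a \<Rightarrow> int"
  assumes fin: "finite A"
    and bool: "\<And>\<pi>. \<pi> permutes A \<Longrightarrow> K + (\<Sum>i\<in>A. C i (\<pi> i)) \<in> {0, 1}"
    and rows: "distinct [a, b, c, d]" "{a, b, c, d} \<subseteq> A"
    and cols: "distinct [j, k, l, m]" "{j, k, l, m} \<subseteq> A"
  shows "minor C a b j k = 0 \<or> minor C c d l m = 0"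
proof -
  define F where "F \<pi> = K + (\<Sum>i\<in>A. C i (\<pi> i))" for \<pi>
  obtain \<pi> where \<pi>: "\<pi> permutes A" "\<pi> a = j" "\<pi> b = k" "\<pi> c = l" "\<pi> d = m"
    using permutes_extend_list[of "[a, b, c, d]" "[j, k, l, m]" A] rows cols by auto
  have A: "a \<in> A" "b \<in> A" "c \<in> A" "d \<in> A" using rows by auto
  let ?s = "transpose a b" and ?t = "transpose c d"
  have step: "F \<sigma> - F (\<sigma> \<circ> transpose x y) = minor C x y (\<sigma> x) (\<sigma> y)"
    if "x \<in> A" "y \<in> A" for \<sigma> x y
    using sum_diff_transpose[OF fin that, of C \<sigma>] by (simp add: F_def)
  have F01: "F \<sigma> \<in> {0, 1}" if "\<sigma> permutes A" for \<sigma>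
    using bool[OF that] by (simp add: F_def)
  have "F \<pi> - F (\<pi> \<circ> ?s) = minor C a b j k" "F \<pi> - F (\<pi> \<circ> ?t) = minor C c d l m"
    "F (\<pi> \<circ> ?s) - F (\<pi> \<circ> ?s \<circ> ?t) = minor C c d l m"
    using step[of a b \<pi>] step[of c d \<pi>] step[of c d "\<pi> \<circ> ?s"] A \<pi> rows
    by (auto simp: transpose_def)
  moreover have "F \<pi> \<in> {0, 1}" "F (\<pi> \<circ> ?s) \<in> {0, 1}" "F (\<pi> \<circ> ?t) \<in> {0, 1}"
    "F (\<pi> \<circ> ?s \<circ> ?t) \<in> {0, 1}"
    by (intro F01 permutes_compose permutes_swap_id A \<pi>(1))+
  ultimately show ?thesis by auto
qed

text \<open>The values at even permutations and at odd permutations have the same sum, so the three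
  Boolean values on each side agree up to order.\<close>

lemma row_star_3:
  fixes C :: "'a \<Rightarrow> 'a \<Rightarrow> int"
  assumes card: "card A = 3"
    and bool: "\<And>\<pi>. \<pi> permutes A \<Longrightarrow> K + (\<Sum>i\<in>A. C i (\<pi> i)) \<in> {0, 1}"
  shows "\<exists>i\<in>A. \<forall>a\<in>A - {i}. \<forall>b\<in>A - {i}. \<forall>j\<in>A. \<forall>k\<in>A. minor C a b j k = 0"
proof -
  obtain x y z where A: "A = {x, y, z}" and neq: "x \<noteq> y" "x \<noteq> z" "y \<noteq> z"
    using card by (auto simp: card_3_iff)
  define G where "G j k l = K + C x j + C y k + C z l" for j k l
  have G: "G j k l \<in> {0, 1}" if jkl: "distinct [j, k, l]" "{j, k, l} \<subseteq> A" for j k l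
  proof -
    obtain \<pi> where "\<pi> permutes A" "\<pi> x = j" "\<pi> y = k" "\<pi> z = l"
      using permutes_extend_list[of "[x, y, z]" "[j, k, l]" A] jkl neq A by auto
    then show ?thesis using bool[of \<pi>] neq A by (simp add: G_def algebra_simps)
  qed
  have vals: "G x y z \<in> {0, 1}" "G y z x \<in> {0, 1}" "G z x y \<in> {0, 1}"
    "G x z y \<in> {0, 1}" "G z y x \<in> {0, 1}" "G y x z \<in> {0, 1}"
    by (rule G; use neq A in auto)+
  have "G x y z + G y z x + G z x y = G x z y + G z y x + G y x z"
    by (simp add: G_def)
  \<comment> \<open>Each even permutation meets each odd one in exactly one of the three matchings.
    If one value on each side is exceptional, the matching that pairs these two works. A matching
    fixes the value at \<open>x\<close>, \<open>y\<close> or \<open>z\<close>, and that row is the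
    centre.\<close>
  then have cases: "(G x y z = G x z y \<and> G y z x = G y x z \<and> G z x y = G z y x) \<or>
      (G x y z = G z y x \<and> G z x y = G y x z \<and> G y z x = G x z y) \<or>
      (G x y z = G y x z \<and> G y z x = G z y x \<and> G z x y = G x z y)"
    using vals by (elim insertE emptyE; simp)
  from cases show ?thesis
  proof (elim disjE)
    assume "G x y z = G x z y \<and> G y z x = G y x z \<and> G z x y = G z y x"
    then show ?thesis by (intro bexI[of _ x]) (auto simp: A minor_def G_def)
  next
    assume "G x y z = G z y x \<and> G z x y = G y x z \<and> G y z x = G x z y"
    then show ?thesis by (intro bexI[of _ y]) (auto simp: A minor_def G_def)
  next
    assume "G x y z = G y x z \<and> G y z x = G z y x \<and> G z x y = G x z y"
    then show ?thesis by (intro bexI[of _ z]) (auto simp: A minor_def G_def)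
  qed
qed

text \<open>All rows but \<open>i\<close> are translates of one row \<open>e\<close>, and the sum of
  row \<open>e\<close> along a permutation is constant, so only the terms at \<open>i\<close>
  vary.\<close>

lemma row_star_imp:
  fixes C :: "'a \<Rightarrow> 'a \<Rightarrow> int"
  assumes fin: "finite A" and i: "i \<in> A"
    and star: "\<And>a b j k. \<lbrakk>a \<in> A - {i}; b \<in> A - {i}; j \<in> A; k \<in> A\<rbrakk> \<Longrightarrow> minor C a b j k = 0"
  shows "\<exists>h. \<forall>\<pi>. \<pi> permutes A \<longrightarrow> (\<Sum>a\<in>A. C a (\<pi> a)) = h (\<pi> i)"
proof (cases "A - {i} = {}")
  case True
  then have "A = {i}" using i by auto
  then show ?thesis by (intro exI[of _ "C i"]) auto
next
  case False
  then obtain e where e: "e \<in> A - {i}" by blast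
  define r where "r a = C a i - C e i" for a
  have C: "C a j = r a + C e j" if "a \<in> A - {i}" "j \<in> A" for a j
    using star[OF that(1) e that(2) i] by (simp add: minor_def r_def)
  have "(\<Sum>a\<in>A. C a (\<pi> a)) =
      C i (\<pi> i) - C e (\<pi> i) + (\<Sum>a\<in>A - {i}. r a) + (\<Sum>j\<in>A. C e j)"
    if \<pi>: "\<pi> permutes A" for \<pi>
  proof -
    have "(\<Sum>j\<in>A. C e j) = (\<Sum>a\<in>A. C e (\<pi> a))"
      using sum.permute[OF \<pi>, of "C e"] by simp
    also have "\<dots> = C e (\<pi> i) + (\<Sum>a\<in>A - {i}. C e (\<pi> a))"
      using fin i by (rule sum.remove)
    finally have col: "(\<Sum>a\<in>A - {i}. C e (\<pi> a)) = (\<Sum>j\<in>A. C e j) - C e (\<pi> i)" by simp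
    have "(\<Sum>a\<in>A. C a (\<pi> a)) = C i (\<pi> i) + (\<Sum>a\<in>A - {i}. C a (\<pi> a))"
      using fin i by (rule sum.remove)
    also have "(\<Sum>a\<in>A - {i}. C a (\<pi> a)) = (\<Sum>a\<in>A - {i}. r a + C e (\<pi> a))"
      using C permutes_in_image[OF \<pi>] by (intro sum.cong) auto
    finally show ?thesis using col by (simp add: sum.distrib)
  qed
  then show ?thesis
    by (intro exI[of _ "\<lambda>j. C i j - C e j + (\<Sum>a\<in>A - {i}. r a) + (\<Sum>j\<in>A. C e j)"]) auto
qed

lemma boolean_linear_imp:
  fixes C :: "'a \<Rightarrow> 'a \<Rightarrow> int"
  assumes fin: "finite A" and ne: "A \<noteq> {}"
    and bool: "\<And>\<pi>. \<pi> permutes A \<Longrightarrow> K + (\<Sum>i\<in>A. C i (\<pi> i)) \<in> {0, 1}"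
  shows "\<exists>i\<in>A. \<exists>h. (\<forall>\<pi>. \<pi> permutes A \<longrightarrow> K + (\<Sum>a\<in>A. C a (\<pi> a)) = h (\<pi> i)) \<or>
                   (\<forall>\<pi>. \<pi> permutes A \<longrightarrow> K + (\<Sum>a\<in>A. C a (\<pi> a)) = h (inv \<pi> i))"
proof -
  have "(\<exists>i\<in>A. \<forall>a\<in>A - {i}. \<forall>b\<in>A - {i}. \<forall>j\<in>A. \<forall>k\<in>A. minor C a b j k = 0) \<or>
        (\<exists>p\<in>A. \<forall>a\<in>A. \<forall>b\<in>A. \<forall>j\<in>A - {p}. \<forall>k\<in>A - {p}. minor C a b j k = 0)"
  proof -
    consider "card A \<le> 2" | "card A = 3" | "card A \<ge> 4" by linarith
    then show ?thesis
    proof cases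
      case 1
      obtain i where i: "i \<in> A" using ne by blast
      then have "card (A - {i}) \<le> 1" using 1 fin by simp
      then have single: "a = b" if "a \<in> A - {i}" "b \<in> A - {i}" for a b
        using that fin by (metis One_nat_def card_le_Suc0_iff_eq finite_Diff)
      have "minor C a b j k = 0" if "a \<in> A - {i}" "b \<in> A - {i}" for a b j k
        using single[OF that] by (simp add: minor_def)
      then show ?thesis using i by blast
    next
      case 2
      then show ?thesis using row_star_3 bool by blast
    next
      case 3
      then show ?thesis
        by (rule row_or_column_star[of A C, OF _ disjoint_minors_vanish[of A K C, OF fin bool]])
    qed
  qed
  then show ?thesis
  proof
    assume "\<exists>i\<in>A. \<forall>a\<in>A - {i}. \<forall>b\<in>A - {i}. \<forall>j\<in>A. \<forall>k\<in>A. minor C a b j k = 0"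
    then obtain i where i: "i \<in> A" "\<And>a b j k. \<lbrakk>a \<in> A - {i}; b \<in> A - {i}; j \<in> A; k \<in> A\<rbrakk> \<Longrightarrow> minor C a b j k = 0"
      by blast
    obtain h where "\<forall>\<pi>. \<pi> permutes A \<longrightarrow> (\<Sum>a\<in>A. C a (\<pi> a)) = h (\<pi> i)"
      using row_star_imp[of A i C, OF fin i] by blast
    then show ?thesis by (intro bexI[OF _ i(1)] exI[of _ "\<lambda>j. K + h j"]) auto
  next
    assume "\<exists>p\<in>A. \<forall>a\<in>A. \<forall>b\<in>A. \<forall>j\<in>A - {p}. \<forall>k\<in>A - {p}. minor C a b j k = 0"
    then obtain i where i: "i \<in> A" "\<And>a b j k. \<lbrakk>a \<in> A; b \<in> A; j \<in> A - {i}; k \<in> A - {i}\<rbrakk> \<Longrightarrow> minor C a b j k = 0"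
      by blast
    \<comment> \<open>The column case is the row case for the transposed matrix, evaluated at
      \<open>inv \<pi>\<close>.\<close>
    have "minor (\<lambda>a b. C b a) a b j k = 0" if "a \<in> A - {i}" "b \<in> A - {i}" "j \<in> A" "k \<in> A" for a b j k
      using i(2)[OF that(3,4,1,2)] by (simp add: minor_def)
    then obtain h where h: "\<And>\<pi>. \<pi> permutes A \<Longrightarrow> (\<Sum>a\<in>A. C (\<pi> a) a) = h (\<pi> i)"
      using row_star_imp[of A i "\<lambda>a b. C b a", OF fin i(1)] by blast
    have "(\<Sum>a\<in>A. C a (\<pi> a)) = h (inv \<pi> i)" if \<pi>: "\<pi> permutes A" for \<pi>
    proof -
      have "(\<Sum>a\<in>A. C a (\<pi> a)) = (\<Sum>a\<in>A. C (inv \<pi> a) (\<pi> (inv \<pi> a)))"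
        using sum.permute[OF permutes_inv[OF \<pi>], of "\<lambda>a. C a (\<pi> a)"] by (simp add: comp_def)
      also have "\<dots> = h (inv \<pi> i)"
        using h[OF permutes_inv[OF \<pi>]] by (simp add: permutes_inverses[OF \<pi>])
      finally show ?thesis .
    qed
    then show ?thesis by (intro bexI[OF _ i(1)] exI[of _ "\<lambda>j. K + h j"]) auto
  qed
qed

section \<open>Functions of one value as dictators\<close>

lemma dictator_row:
  assumes i: "i \<in> {1..n}" and g: "\<And>\<pi>. \<pi> \<in> Sym n \<Longrightarrow> g \<pi> = h (\<pi> i)"
    and bool: "\<And>\<pi>. \<pi> \<in> Sym n \<Longrightarrow> g \<pi> \<in> {0, 1}"
  shows "dictator n g"
proof -
  let ?J = "{j \<in> {1..n}. h j = 1}"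
  have "g \<pi> = (\<Sum>(a, j)\<in>{i} \<times> ?J. xvar a j \<pi>)" if \<pi>: "\<pi> \<in> Sym n" for \<pi>
  proof -
    have "\<pi> i \<in> {1..n}" using \<pi> i permutes_in_image[of \<pi> "{1..n}" i] by (simp add: Sym_def)
    moreover have "(\<Sum>(a, j)\<in>{i} \<times> ?J. xvar a j \<pi>) = (\<Sum>j\<in>?J. xvar i j \<pi>)"
      by (subst sum.cartesian_product[symmetric]) simp
    moreover have "\<dots> = (if \<pi> i \<in> ?J then 1 else 0)"
      by (simp add: xvar_def)
    ultimately show ?thesis using g[OF \<pi>] bool[OF \<pi>] by auto
  qed
  then show ?thesis
    unfolding dictator_def using i by (intro exI[of _ "{i} \<times> ?J"]) auto
qed

lemma dictator_column:
  assumes j: "j \<in> {1..n}" and g: "\<And>\<pi>. \<pi> \<in> Sym n \<Longrightarrow> g \<pi> = h (inv \<pi> j)"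
    and bool: "\<And>\<pi>. \<pi> \<in> Sym n \<Longrightarrow> g \<pi> \<in> {0, 1}"
  shows "dictator n g"
proof -
  let ?I = "{i \<in> {1..n}. h i = 1}"
  have "g \<pi> = (\<Sum>(i, b)\<in>?I \<times> {j}. xvar i b \<pi>)" if \<pi>: "\<pi> \<in> Sym n" for \<pi>
  proof -
    have p: "\<pi> permutes {1..n}" using \<pi> unfolding Sym_def by simp
    have "inv \<pi> j \<in> {1..n}" using j permutes_in_image[OF permutes_inv[OF p]] by blast
    moreover have "(\<Sum>(i, b)\<in>?I \<times> {j}. xvar i b \<pi>) = (\<Sum>i\<in>?I. xvar i j \<pi>)"
      by (subst sum.cartesian_product[symmetric]) simp
    moreover have "xvar i j \<pi> = (if inv \<pi> j = i then 1 else 0)" for i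
      using permutes_inverses[OF p] by (auto simp: xvar_def)
    then have "(\<Sum>i\<in>?I. xvar i j \<pi>) = (if inv \<pi> j \<in> ?I then 1 else 0)"
      by simp
    ultimately show ?thesis using g[OF \<pi>] bool[OF \<pi>] by auto
  qed
  then show ?thesis
    unfolding dictator_def using j by (intro exI[of _ "?I \<times> {j}"]) auto
qed

section \<open>Rounding and exact linearity\<close>

lemma round01_cases: "round01 y \<in> {0, 1}"
  unfolding round01_def by (rule arg_min_if_finite) auto

text \<open>At the tie both candidates are equally near, so the identity holds whichever is
  chosen.\<close>

lemma abs_diff_round01: "\<bar>y - round01 y\<bar> = dist01 y"
  using arg_min_least[of "{0, 1}" 0 "\<lambda>b. \<bar>y - b\<bar>"] arg_min_least[of "{0, 1}" 1 "\<lambda>b. \<bar>y - b\<bar>"]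
    round01_cases[of y]
  unfolding dist01_def round01_def[symmetric] by auto

lemma rounded_linear_exact:
  fixes c :: "'a \<Rightarrow> 'a \<Rightarrow> real"
  assumes fin: "finite A" and ne: "A \<noteq> {}" and eps: "\<epsilon> \<le> 1 / 20"
    and bool: "\<And>\<pi>. \<pi> permutes A \<Longrightarrow> g \<pi> \<in> {0, 1}"
    and close: "\<And>\<pi>. \<pi> permutes A \<Longrightarrow> \<bar>(\<Sum>i\<in>A. c i (\<pi> i)) - g \<pi>\<bar> \<le> \<epsilon>"
  shows "\<exists>(C :: 'a \<Rightarrow> 'a \<Rightarrow> int) K. \<forall>\<pi>. \<pi> permutes A \<longrightarrow> g \<pi> = of_int (K + (\<Sum>i\<in>A. C i (\<pi> i)))"
proof -
  obtain e where e: "e \<in> A" using ne by blast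
  have step: "\<exists>z. g \<pi> - g (\<pi> \<circ> transpose a b) = of_int z \<and> \<bar>minor c a b (\<pi> a) (\<pi> b) - of_int z\<bar> \<le> 2 * \<epsilon>"
    if \<pi>: "\<pi> permutes A" and ab: "a \<in> A" "b \<in> A" for \<pi> a b
  proof -
    have \<tau>: "\<pi> \<circ> transpose a b permutes A"
      using \<pi> ab by (intro permutes_compose permutes_swap_id)
    obtain x y :: int where "g \<pi> = of_int x" "g (\<pi> \<circ> transpose a b) = of_int y"
      using bool[OF \<pi>] bool[OF \<tau>] by (metis insertE of_int_0 of_int_1 singletonD)
    then show ?thesis
      using close[OF \<pi>] close[OF \<tau>] sum_diff_transpose[OF fin ab, of c \<pi>]
      by (intro exI[of _ "x - y"]) auto
  qed
  have eps0: "0 \<le> \<epsilon>" using close[OF permutes_id] by linarith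
  \<comment> \<open>Minors anchored at row \<open>e\<close> and column \<open>e\<close> determine
    all others, so rounding only these yields one consistent integer matrix.\<close>
  define C where "C a j = round (minor c a e j e)" for a j
  have C: "\<bar>minor c a e j e - of_int (C a j)\<bar> \<le> 2 * \<epsilon>" if aj: "a \<in> A" "j \<in> A" for a j
  proof -
    \<comment> \<open>Off the anchor, a permutation with \<open>a\<close> sent to \<open>j\<close>
      and \<open>e\<close> fixed realises this minor as a change of the linear sum, so
      \<open>step\<close> puts it near an integer.\<close>
    have "\<exists>z :: int. \<bar>minor c a e j e - of_int z\<bar> \<le> 2 * \<epsilon>"
    proof (cases "a = e \<or> j = e")
      case True
      then show ?thesis using eps0 by (intro exI[of _ 0]) (auto simp: minor_def)
    next
      case False
      then obtain \<pi> where "\<pi> permutes A" "\<pi> a = j" "\<pi> e = e"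
        using permutes_extend_list[of "[a, e]" "[j, e]" A] e aj by auto
      then show ?thesis using step[of \<pi> a e] e aj by auto
    qed
    then obtain z :: int where "\<bar>minor c a e j e - of_int z\<bar> \<le> 2 * \<epsilon>" by blast
    then show ?thesis
      using round_diff_minimal[of "minor c a e j e" z] unfolding C_def by linarith
  qed
  define F where "F \<pi> = (\<Sum>i\<in>A. C i (\<pi> i))" for \<pi>
  have eq: "g \<pi> - g (\<pi> \<circ> transpose a b) = of_int (F \<pi> - F (\<pi> \<circ> transpose a b))"
    if \<pi>: "\<pi> permutes A" and ab: "a \<in> A" "b \<in> A" for \<pi> a b
  proof -
    have im: "\<pi> a \<in> A" "\<pi> b \<in> A" using permutes_in_image[OF \<pi>] ab by auto
    obtain z where z: "g \<pi> - g (\<pi> \<circ> transpose a b) = of_int z"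
      "\<bar>minor c a b (\<pi> a) (\<pi> b) - of_int z\<bar> \<le> 2 * \<epsilon>"
      using step[OF \<pi> ab] by blast
    have "minor c a b (\<pi> a) (\<pi> b) = minor c a e (\<pi> a) e + minor c b e (\<pi> b) e
        - minor c a e (\<pi> b) e - minor c b e (\<pi> a) e"
      by (simp add: minor_def)
    moreover have "real_of_int (minor C a b (\<pi> a) (\<pi> b)) =
        of_int (C a (\<pi> a)) + of_int (C b (\<pi> b)) - of_int (C a (\<pi> b)) - of_int (C b (\<pi> a))"
      by (simp add: minor_def)
    \<comment> \<open>Four anchored minors and the estimate for \<open>z\<close> each contribute
      \<open>2 * \<epsilon>\<close>. As \<open>\<epsilon>\<close> is at most 1/20, the total is at
      most 1/2, and integers that close are equal.\<close>
    ultimately have "\<bar>real_of_int (minor C a b (\<pi> a) (\<pi> b)) - of_int z\<bar> \<le> 10 * \<epsilon>"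
      using z(2) C[OF ab(1) im(1)] C[OF ab(2) im(2)] C[OF ab(1) im(2)] C[OF ab(2) im(1)]
      by linarith
    then have "minor C a b (\<pi> a) (\<pi> b) = z" using eps by linarith
    then show ?thesis
      using z(1) sum_diff_transpose[OF fin ab, of C \<pi>] by (simp add: F_def)
  qed
  \<comment> \<open>By \<open>eq\<close>, the difference of \<open>g\<close> and \<open>F\<close> is
    invariant under transpositions; its value at \<open>id\<close> is the integer constant
    \<open>K\<close>.\<close>
  have const: "g \<pi> - of_int (F \<pi>) = g id - of_int (F id)" if "\<pi> permutes A" for \<pi>
    using fin that
  proof (induction rule: permutes_rev_induct)
    case (swap a b p)
    then show ?case using eq[of p a b] unfolding of_int_diff by linarith
  qed simp
  obtain k :: int where k: "g id = of_int k"
    using bool[OF permutes_id] by (metis insertE of_int_0 of_int_1 singletonD)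
  have "g \<pi> = of_int (k - F id + F \<pi>)" if "\<pi> permutes A" for \<pi>
    using const[OF that] k by simp
  then show ?thesis unfolding F_def by blast
qed

theorem theorem1p4:
  "\<exists>\<epsilon>\<^sub>0 :: real. \<epsilon>\<^sub>0 > 0 \<and>
     (\<forall>(n::nat) (\<epsilon>::real) (f :: (nat \<Rightarrow> nat) \<Rightarrow> real).
        n \<ge> 1 \<longrightarrow> 0 \<le> \<epsilon> \<longrightarrow> \<epsilon> \<le> \<epsilon>\<^sub>0 \<longrightarrow>
        linear_on_Sym n f \<longrightarrow>
        (\<forall>\<pi>\<in>Sym n. dist01 (f \<pi>) \<le> \<epsilon>) \<longrightarrow>
        dictator n (\<lambda>\<pi>. round01 (f \<pi>)))"
proof (intro exI[of _ "1 / 20"] conjI allI impI)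
  fix n :: nat and \<epsilon> :: real and f :: "(nat \<Rightarrow> nat) \<Rightarrow> real"
  assume n: "n \<ge> 1" and eps: "\<epsilon> \<le> 1 / 20" and lin: "linear_on_Sym n f"
    and close: "\<forall>\<pi>\<in>Sym n. dist01 (f \<pi>) \<le> \<epsilon>"
  let ?g = "\<lambda>\<pi>. round01 (f \<pi>)"
  obtain c where c: "\<forall>\<pi>\<in>Sym n. f \<pi> = (\<Sum>i\<in>{1..n}. \<Sum>j\<in>{1..n}. c i j * xvar i j \<pi>)"
    using lin unfolding linear_on_Sym_def by blast
  have f: "f \<pi> = (\<Sum>i\<in>{1..n}. c i (\<pi> i))" if \<pi>: "\<pi> permutes {1..n}" for \<pi>
  proof -
    have "(\<Sum>j\<in>{1..n}. c i j * xvar i j \<pi>) = c i (\<pi> i)" if "i \<in> {1..n}" for i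
    proof -
      have "(\<Sum>j\<in>{1..n}. c i j * xvar i j \<pi>) = (\<Sum>j\<in>{1..n}. if \<pi> i = j then c i j else 0)"
        by (intro sum.cong) (auto simp: xvar_def)
      then show ?thesis using permutes_in_image[OF \<pi>, of i] that by simp
    qed
    then show ?thesis using c \<pi> by (simp add: Sym_def)
  qed
  have "\<bar>(\<Sum>i\<in>{1..n}. c i (\<pi> i)) - ?g \<pi>\<bar> \<le> \<epsilon>" if "\<pi> permutes {1..n}" for \<pi>
    using close that unfolding f[OF that, symmetric] abs_diff_round01 Sym_def by blast
  then have "\<exists>(C :: nat \<Rightarrow> nat \<Rightarrow> int) K. \<forall>\<pi>. \<pi> permutes {1..n} \<longrightarrow>
      ?g \<pi> = of_int (K + (\<Sum>i\<in>{1..n}. C i (\<pi> i)))"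
    using n eps round01_cases by (intro rounded_linear_exact[of "{1..n}" \<epsilon> ?g c]) auto
  then obtain C :: "nat \<Rightarrow> nat \<Rightarrow> int" and K where
    C: "\<And>\<pi>. \<pi> permutes {1..n} \<Longrightarrow> ?g \<pi> = of_int (K + (\<Sum>i\<in>{1..n}. C i (\<pi> i)))"
    by blast
  have "K + (\<Sum>i\<in>{1..n}. C i (\<pi> i)) \<in> {0, 1}" if "\<pi> permutes {1..n}" for \<pi>
  proof -
    have "real_of_int (K + (\<Sum>i\<in>{1..n}. C i (\<pi> i))) \<in> {0, 1}"
      unfolding C[OF that, symmetric] by (rule round01_cases)
    then show ?thesis by (simp only: insert_iff empty_iff of_int_eq_0_iff of_int_eq_1_iff)
  qed
  then have "\<exists>i\<in>{1..n}. \<exists>h.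
      (\<forall>\<pi>. \<pi> permutes {1..n} \<longrightarrow> K + (\<Sum>a\<in>{1..n}. C a (\<pi> a)) = h (\<pi> i)) \<or>
      (\<forall>\<pi>. \<pi> permutes {1..n} \<longrightarrow> K + (\<Sum>a\<in>{1..n}. C a (\<pi> a)) = h (inv \<pi> i))"
    using n by (intro boolean_linear_imp) auto
  then obtain i h where i: "i \<in> {1..n}" and
    "(\<forall>\<pi>. \<pi> permutes {1..n} \<longrightarrow> K + (\<Sum>a\<in>{1..n}. C a (\<pi> a)) = h (\<pi> i)) \<or>
     (\<forall>\<pi>. \<pi> permutes {1..n} \<longrightarrow> K + (\<Sum>a\<in>{1..n}. C a (\<pi> a)) = h (inv \<pi> i))"
    by blast
  then show "dictator n ?g"
  proof (elim disjE)
    assume h: "\<forall>\<pi>. \<pi> permutes {1..n} \<longrightarrow> K + (\<Sum>a\<in>{1..n}. C a (\<pi> a)) = h (\<pi> i)"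
    show ?thesis
    proof (rule dictator_row[OF i])
      fix \<pi> assume "\<pi> \<in> Sym n"
      then have "\<pi> permutes {1..n}" by (simp add: Sym_def)
      then show "?g \<pi> = real_of_int (h (\<pi> i))" by (simp only: C h)
    qed (rule round01_cases)
  next
    assume h: "\<forall>\<pi>. \<pi> permutes {1..n} \<longrightarrow> K + (\<Sum>a\<in>{1..n}. C a (\<pi> a)) = h (inv \<pi> i)"
    show ?thesis
    proof (rule dictator_column[OF i])
      fix \<pi> assume "\<pi> \<in> Sym n"
      then have "\<pi> permutes {1..n}" by (simp add: Sym_def)
      then show "?g \<pi> = real_of_int (h (inv \<pi> i))" by (simp only: C h)
    qed (rule round01_cases)
  qed
qed simp

end
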